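(* Let $k$ be a positive integer and $c$ a non-negative integer, and let $G$ be a graph such that $\chi(G) > \max\{c+2k-2,\,2k^2\}$. Then $G$ contains a $(k+1)$-connected induced subgraph of chromatic number greater than $c$.
   Context: All graphs are finite and simple. $\chi(G)$ denotes the chromatic number of $G$. A cutset of a graph $G$ is a (possibly empty) set $C \subseteq V(G)$ such that $G \smallsetminus C$ is disconnected. A graph is $k$-connected if it has at least $k+1$ vertices and has no cutset of size at most $k-1$. *)

theory Defs
  imports "Graph_Theory.Digraph_Component"
begin

text \<open>
  Finite simple graphs are rendered by the locale \<^locale>\<open>graph\<close>: finite, loop-free
  symmetric digraphs without parallel arcs. An undirected edge is a pair of opposite arcs,
  so \<open>u \<rightarrow>\<^bsub>G\<^esub> v\<close> is adjacency.
\<close>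

definition proper_colouring :: "('a, 'b) pre_digraph \<Rightarrow> ('a \<Rightarrow> 'c) \<Rightarrow> bool" where
  "proper_colouring G f \<longleftrightarrow>
     (\<forall>u \<in> verts G. \<forall>v \<in> verts G. u \<rightarrow>\<^bsub>G\<^esub> v \<longrightarrow> f u \<noteq> f v)"

text \<open>
  The minimum exists for finite loop-free \<open>G\<close>; in other cases the value may be unspecified.
\<close>
definition chromatic_number :: "('a, 'b) pre_digraph \<Rightarrow> nat" where
  "chromatic_number G =
     (LEAST n. \<exists>f :: 'a \<Rightarrow> nat. f ` verts G \<subseteq> {..<n} \<and> proper_colouring G f)"

text \<open>
  The library's \<^const>\<open>connected\<close> is false for the null graph, which here does not count as
  disconnected. This only affects \<open>C = verts G\<close>, which is too large to matter in
  \<open>k_connected\<close> below.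
\<close>
definition cutset :: "('a, 'b) pre_digraph \<Rightarrow> 'a set \<Rightarrow> bool" where
  "cutset G C \<longleftrightarrow>
     C \<subseteq> verts G \<and> C \<noteq> verts G \<and> \<not> connected (G \<restriction> (verts G - C))"

text \<open>
  The bound \<open>card C < k\<close> avoids the truncated subtraction \<open>k - 1\<close> on natural numbers at
  \<open>k = 0\<close>.
\<close>
definition k_connected :: "nat \<Rightarrow> ('a, 'b) pre_digraph \<Rightarrow> bool" where
  "k_connected k G \<longleftrightarrow>
     k + 1 \<le> card (verts G) \<and> \<not> (\<exists>C. cutset G C \<and> card C < k)"

end

theory Submission
  imports Defs "HOL-Number_Theory.Cong"
begin

text \<open>
  Put \<open>m = max (c + 2 * k - 2) (2 * k\<^sup>2)\<close> and suppose that every \<open>(k + 1)\<close>-connected induced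
  subgraph is \<open>c\<close>-colourable. The claim is that \<open>G\<close> is then \<open>m\<close>-colourable, and the natural
  proof is to split along cutsets of at most \<open>k\<close> vertices, colour one side, and let the colours
  on the cutset be a precolouring of the other side. This needs an induction hypothesis about
  partial colourings that survives repeated splitting.

  The right one gives every vertex a demand: \<open>k\<close> if it is precoloured, and otherwise the number
  of colours that are forbidden at it. As long as the total demand stays below \<open>2 * k\<^sup>2\<close>, the
  partial data extend to a colouring with \<open>m\<close> colours
  (\<open>extendable_if_all_colourable_or_separable\<close>).

  At a separation with sides \<open>A\<close>, \<open>B\<close> and cutset \<open>C\<close>, let \<open>A\<close> be the side of smaller demand,
  which is below \<open>k\<^sup>2\<close>. The part \<open>B \<union> C\<close> is coloured first. A precoloured vertex of \<open>A\<close> is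
  accounted for by forbidding its colour on \<open>C\<close>; this removes demand \<open>k\<close> and adds at most
  \<open>card C \<le> k\<close>, so the total does not grow. Then \<open>A \<union> C\<close> is coloured with \<open>C\<close> precoloured;
  the cutset has demand at most \<open>k\<^sup>2\<close>, so the total is again below \<open>2 * k\<^sup>2\<close>. This is where the
  bound \<open>2 * k\<^sup>2\<close> comes from (\<open>extendable_if_separable\<close>).

  If there is no such separation, the graph has a colouring with \<open>m + 2 - 2 * k\<close> colours: it is
  \<open>(k + 1)\<close>-connected, hence \<open>c\<close>-colourable, or it has at most \<open>k + 1\<close> vertices. Since fewer than
  \<open>2 * k\<close> vertices are precoloured, enough colours remain to rename the colour classes, and a
  counting argument finds a renaming that violates no forbidden colour
  (\<open>extendable_if_colourable\<close>).
\<close>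

section \<open>Injections avoiding few pairs\<close>

text \<open>
  Identify \<open>T\<close> with the integers modulo \<open>card T\<close>, fix one injection of \<open>I\<close>, and compose it with
  the \<open>card T\<close> cyclic shifts. Each bad pair lies on the graph of at most one shift, so some shift
  avoids them all.
\<close>
lemma injection_avoiding_few_pairs:
  fixes I :: "'i set" and T :: "'t set" and Bad :: "('i \<times> 't) set"
  assumes "finite I" "finite T" "card I \<le> card T" "finite Bad" "card Bad < card T"
  shows "\<exists>\<pi>. inj_on \<pi> I \<and> \<pi> ` I \<subseteq> T \<and> (\<forall>i\<in>I. (i, \<pi> i) \<notin> Bad)"
proof -
  define N where "N = card T"
  have N: "N > 0" using assms(5) by (simp add: N_def)
  obtain e where e: "bij_betw e {..<N} T"
    using ex_bij_betw_nat_finite[OF \<open>finite T\<close>] by (auto simp: N_def lessThan_atLeast0)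
  obtain r where r: "inj_on r I" "r ` I \<subseteq> {..<N}"
    using card_le_inj[of I "{..<N}"] assms by (auto simp: N_def)
  define shift where "shift s i = e ((r i + s) mod N)" for s i
  have e_inj: "x mod N = y mod N" if "e (x mod N) = e (y mod N)" for x y
    using that e N by (auto simp: bij_betw_def dest!: inj_onD)
  have shift_inj: "s = s'" if "shift s i = shift s' i" "s < N" "s' < N" for s s' i
  proof -
    have "[r i + s = r i + s'] (mod N)"
      using that(1) unfolding shift_def cong_def by (rule e_inj)
    then have "[s = s'] (mod N)"
      by (simp add: cong_add_lcancel_nat)
    then show ?thesis
      using that(2,3) by (simp add: cong_less_modulus_unique_nat)
  qed
  \<comment> \<open>the shifts spoilt by some bad pair\<close>
  define D where "D = {s. s < N \<and> (\<exists>i\<in>I. (i, shift s i) \<in> Bad)}"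
  then have "\<forall>s\<in>D. \<exists>i. i \<in> I \<and> (i, shift s i) \<in> Bad" by blast
  then obtain w where w: "\<And>s. s \<in> D \<Longrightarrow> w s \<in> I \<and> (w s, shift s (w s)) \<in> Bad"
    by metis
  have "inj_on (\<lambda>s. (w s, shift s (w s))) D"
    by (rule inj_onI) (auto simp: D_def intro: shift_inj)
  then have "card D \<le> card Bad"
    using w \<open>finite Bad\<close> by (intro card_inj_on_le[where f = "\<lambda>s. (w s, shift s (w s))"]) auto
  then have "card D < card {..<N}"
    using assms(5) by (simp add: N_def)
  then have "D \<noteq> {..<N}" by auto
  moreover have "D \<subseteq> {..<N}" by (auto simp: D_def)
  ultimately obtain s where s: "s < N" "s \<notin> D" by auto
  show ?thesis
  proof (intro exI[of _ "shift s"] conjI)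
    show "inj_on (shift s) I"
    proof (rule inj_onI)
      fix i j assume ij: "i \<in> I" "j \<in> I" "shift s i = shift s j"
      have "[r i + s = r j + s] (mod N)"
        using ij(3) unfolding shift_def cong_def by (rule e_inj)
      then have "[r i = r j] (mod N)"
        by (simp add: cong_add_rcancel_nat)
      then have "r i = r j"
        using ij r(2) by (intro cong_less_modulus_unique_nat) auto
      with ij r(1) show "i = j" by (auto dest: inj_onD)
    qed
    show "shift s ` I \<subseteq> T"
      using e N by (auto simp: shift_def bij_betw_def)
    show "\<forall>i\<in>I. (i, shift s i) \<notin> Bad"
      using s by (auto simp: D_def)
  qed
qed

section \<open>Extending a precolouring\<close>

definition proper_on :: "('a \<Rightarrow> 'a \<Rightarrow> bool) \<Rightarrow> 'a set \<Rightarrow> ('a \<Rightarrow> 'c) \<Rightarrow> bool" where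
  "proper_on adj X f \<longleftrightarrow> (\<forall>u\<in>X. \<forall>v\<in>X. adj u v \<longrightarrow> f u \<noteq> f v)"

lemma proper_on_subset: "proper_on adj X f \<Longrightarrow> Y \<subseteq> X \<Longrightarrow> proper_on adj Y f"
  by (auto simp: proper_on_def)

definition colourable_on :: "('a \<Rightarrow> 'a \<Rightarrow> bool) \<Rightarrow> 'a set \<Rightarrow> nat \<Rightarrow> bool" where
  "colourable_on adj X p \<longleftrightarrow> (\<exists>\<phi>. \<phi> ` X \<subseteq> {..<p} \<and> proper_on adj X \<phi>)"

definition separable :: "('a \<Rightarrow> 'a \<Rightarrow> bool) \<Rightarrow> nat \<Rightarrow> 'a set \<Rightarrow> bool" where
  "separable adj k X \<longleftrightarrow>
     (\<exists>A B C. X = A \<union> B \<union> C \<and> A \<inter> B = {} \<and> A \<inter> C = {} \<and> B \<inter> C = {} \<and>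
        A \<noteq> {} \<and> B \<noteq> {} \<and> card C \<le> k \<and> (\<forall>u\<in>A. \<forall>v\<in>B. \<not> adj u v))"

text \<open>
  Here \<open>S\<close> is the set of precoloured vertices and \<open>F v\<close> the set of colours forbidden at an
  uncoloured vertex \<open>v\<close>. Precoloured vertices count \<open>k\<close> because, across a separation of order
  \<open>k\<close>, a precoloured vertex can be traded for one forbidden colour at each cutset vertex.
\<close>
definition demand :: "nat \<Rightarrow> 'a set \<Rightarrow> ('a \<Rightarrow> nat set) \<Rightarrow> 'a set \<Rightarrow> nat" where
  "demand k S F X = k * card (S \<inter> X) + (\<Sum>v\<in>X - S. card (F v))"

lemma demand_Un:
  assumes "finite X" "finite Y" "X \<inter> Y = {}"
  shows "demand k S F (X \<union> Y) = demand k S F X + demand k S F Y"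
proof -
  have "card (S \<inter> (X \<union> Y)) = card (S \<inter> X) + card (S \<inter> Y)"
    using assms by (subst card_Un_disjoint[symmetric]) (auto simp: Int_Un_distrib)
  moreover have "(\<Sum>v\<in>X \<union> Y - S. card (F v)) = (\<Sum>v\<in>X - S. card (F v)) + (\<Sum>v\<in>Y - S. card (F v))"
    using assms by (subst sum.union_disjoint[symmetric]) (auto simp: Un_Diff)
  ultimately show ?thesis by (simp add: demand_def algebra_simps)
qed

lemma demand_cong:
  assumes "S \<inter> X = S' \<inter> X" "\<And>v. v \<in> X - S \<Longrightarrow> F v = F' v"
  shows "demand k S F X = demand k S' F' X"
proof -
  have "X - S = X - S'" using assms(1) by blast
  then show ?thesis using assms by (simp add: demand_def)
qed

definition extendable ::
    "('a \<Rightarrow> 'a \<Rightarrow> bool) \<Rightarrow> nat \<Rightarrow> 'a set \<Rightarrow> 'a set \<Rightarrow> ('a \<Rightarrow> nat) \<Rightarrow> ('a \<Rightarrow> nat set) \<Rightarrow> bool" where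
  "extendable adj m X S f F \<longleftrightarrow>
     (\<exists>g. g ` X \<subseteq> {..<m} \<and> proper_on adj X g \<and>
        (\<forall>v\<in>X \<inter> S. g v = f v) \<and> (\<forall>v\<in>X - S. g v \<notin> F v))"

lemma three_mult_le: "3 * k \<le> 2 * k\<^sup>2 + 1" for k :: nat
proof (cases "k \<le> 1")
  case False
  then have "3 * k \<le> (2 * k) * k" by (intro mult_le_mono1) simp
  then show ?thesis unfolding power2_eq_square by linarith
qed (auto simp: le_Suc_eq)

lemma card_conflicts_le:
  assumes "finite V" "\<And>v. v \<in> V \<Longrightarrow> finite (F v)"
  shows "finite {(\<phi> v, x) | v x. v \<in> V \<and> x \<in> F v}" (is "finite ?Bad")
    and "card {(\<phi> v, x) | v x. v \<in> V \<and> x \<in> F v} \<le> (\<Sum>v\<in>V. card (F v))"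
proof -
  have eq: "?Bad = (\<lambda>(v, x). (\<phi> v, x)) ` Sigma V F" by force
  show "finite ?Bad" using assms by (simp add: eq)
  show "card ?Bad \<le> (\<Sum>v\<in>V. card (F v))"
    unfolding eq using card_image_le[of "Sigma V F"] assms by fastforce
qed

text \<open>
  Keep the prescribed colours on \<open>S\<close> and colour the rest by \<open>\<phi>\<close> followed by an injection of its
  colours into those not used on \<open>S\<close>. If at most \<open>2 * k - 2\<close> colours are used on \<open>S\<close>, the
  \<open>m + 2 - 2 * k\<close> colours of \<open>\<phi>\<close> fit into the remaining ones, and the demand bound leaves fewer
  conflicts than remaining colours, so a conflict-free injection exists.

  Otherwise \<open>S\<close> has \<open>2 * k - 1\<close> vertices of distinct colours, and one colour is missing. But then
  the remaining demand is below \<open>k\<close>, so some \<open>s\<close> in \<open>S\<close> has a colour that is forbidden nowhere,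
  and this colour can be used for the whole \<open>\<phi>\<close>-class of \<open>s\<close>.
\<close>
lemma extendable_if_colourable:
  assumes fin: "finite X" "\<And>v. v \<in> X - S \<Longrightarrow> finite (F v)"
    and sym: "\<And>u v. adj u v \<Longrightarrow> adj v u"
    and k: "k \<ge> 1" "2 * k\<^sup>2 \<le> m"
    and col: "colourable_on adj X (m + 2 - 2 * k)"
    and S: "S \<subseteq> X" "proper_on adj S f" "f ` S \<subseteq> {..<m}"
    and dem: "demand k S F X < 2 * k\<^sup>2"
  shows "extendable adj m X S f F"
proof -
  define p where "p = m + 2 - 2 * k"
  obtain \<phi> where \<phi>: "\<phi> ` X \<subseteq> {..<p}" "proper_on adj X \<phi>"
    using col by (auto simp: colourable_on_def p_def)
  define W where "W = (\<Sum>v\<in>X - S. card (F v))"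
  have finS: "finite S" using S(1) fin(1) by (rule finite_subset)
  have dem': "k * card S + W < 2 * k * k"
    using dem S(1) by (simp add: demand_def W_def Int_absorb2 power2_eq_square mult.assoc)
  have m: "2 * k * k \<le> m" using k(2) by (simp add: power2_eq_square mult.assoc)
  have "k * card S < k * (2 * k)" using dem' by (simp only: mult.assoc mult.left_commute)
  then have cardS: "card S < 2 * k" by (simp only: mult_less_cancel1)
  define T where "T = {..<m} - f ` S"
  have cardT: "card T = m - card (f ` S)"
    using S(3) finS by (simp add: T_def card_Diff_subset)
  have fT: "f u \<noteq> x" if "u \<in> S" "x \<in> T" for u x
    using that by (auto simp: T_def)
  define Bad where "Bad = {(\<phi> v, x) | v x. v \<in> X - S \<and> x \<in> F v}"
  have Bad: "finite Bad" "card Bad \<le> W"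
    unfolding Bad_def W_def using card_conflicts_le[of "X - S" F \<phi>] fin by auto
  have mk: "2 * k \<le> m"
    using m mult_le_mono2[OF k(1), of "2 * k"] by linarith
  show ?thesis
  proof (cases "card (f ` S) \<le> 2 * k - 2")
    case True
    have "card {..<p} \<le> card T" using True k(1) mk by (simp add: cardT p_def)
    moreover have "card Bad < card T"
    proof -
      have "card (f ` S) \<le> k * card S"
        using card_image_le[OF finS, of f] mult_le_mono1[OF k(1), of "card S"] by linarith
      then show ?thesis using dem' m Bad(2) by (simp add: cardT)
    qed
    ultimately obtain \<pi> where \<pi>: "inj_on \<pi> {..<p}" "\<pi> ` {..<p} \<subseteq> T" "\<forall>i\<in>{..<p}. (i, \<pi> i) \<notin> Bad"
      using injection_avoiding_few_pairs[of "{..<p}" T Bad] Bad(1) by (auto simp: T_def)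
    define g where "g v = (if v \<in> S then f v else \<pi> (\<phi> v))" for v
    have \<pi>T: "\<pi> (\<phi> v) \<in> T" if "v \<in> X" for v using \<pi>(2) \<phi>(1) that by blast
    have "proper_on adj X g"
      unfolding proper_on_def
    proof (intro ballI impI)
      fix u v assume uv: "u \<in> X" "v \<in> X" "adj u v"
      show "g u \<noteq> g v"
      proof (cases "u \<in> S \<or> v \<in> S")
        case True
        then show ?thesis
          using uv S(2) fT[OF _ \<pi>T[of v], of u] fT[OF _ \<pi>T[of u], of v]
          by (auto simp: g_def proper_on_def)
      next
        case False
        have "\<phi> u \<noteq> \<phi> v" using uv \<phi>(2) by (auto simp: proper_on_def)
        then have "\<pi> (\<phi> u) \<noteq> \<pi> (\<phi> v)"
          using uv \<phi>(1) \<pi>(1) by (auto dest: inj_onD)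
        then show ?thesis using False by (simp add: g_def)
      qed
    qed
    moreover have "g v \<notin> F v" if "v \<in> X - S" for v
      using that \<pi>(3) \<phi>(1) by (fastforce simp: g_def Bad_def)
    moreover have "g ` X \<subseteq> {..<m}"
      using S(3) \<pi>T by (auto simp: g_def T_def)
    ultimately show ?thesis
      unfolding extendable_def by (intro exI[of _ g]) (auto simp: g_def)
  next
    case False
    have full: "card S = 2 * k - 1" "card (f ` S) = card S"
      using False cardS card_image_le[OF finS, of f] by auto
    have inj: "inj_on f S" using full(2) finS by (simp add: eq_card_imp_inj_on)
    have W: "W < k"
    proof -
      have "k * card S + k = 2 * k * k"
      proof -
        have "card S + 1 = 2 * k" using full(1) k(1) by simp
        then have "k * (card S + 1) = k * (2 * k)" by simp
        then show ?thesis by (simp add: algebra_simps)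
      qed
      then show ?thesis using dem' by linarith
    qed
    have "card (\<Union>v\<in>X - S. F v) \<le> W"
      unfolding W_def using fin by (intro card_UN_le) auto
    then have "card (\<Union>v\<in>X - S. F v) < card (f ` S)"
      using W full k(1) by simp
    then have "\<not> f ` S \<subseteq> (\<Union>v\<in>X - S. F v)"
      using card_mono[of "\<Union>v\<in>X - S. F v" "f ` S"] fin by (meson finite_Diff finite_UN leD)
    then obtain s where s: "s \<in> S" "\<And>v. v \<in> X - S \<Longrightarrow> f s \<notin> F v" by blast
    define I where "I = {..<p} - {\<phi> s}"
    have \<phi>s: "\<phi> s < p" using s(1) S(1) \<phi>(1) by auto
    have "card I \<le> card T"
      using \<phi>s full k(1) mk by (simp add: I_def cardT p_def)
    moreover have "card Bad < card T"
    proof -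
      have "card T = m - (2 * k - 1)" using full by (simp add: cardT)
      then show ?thesis
        using three_mult_le[of k] Bad(2) W k by linarith
    qed
    ultimately obtain \<pi> where \<pi>: "inj_on \<pi> I" "\<pi> ` I \<subseteq> T" "\<forall>i\<in>I. (i, \<pi> i) \<notin> Bad"
      using injection_avoiding_few_pairs[of I T Bad] Bad(1) by (auto simp: T_def I_def)
    define g where "g v = (if v \<in> S then f v else if \<phi> v = \<phi> s then f s else \<pi> (\<phi> v))" for v
    have \<phi>I: "\<phi> v \<in> I" if "v \<in> X" "\<phi> v \<noteq> \<phi> s" for v using \<phi>(1) that by (auto simp: I_def)
    have \<pi>T: "\<pi> (\<phi> v) \<in> T" if "v \<in> X" "\<phi> v \<noteq> \<phi> s" for v using \<pi>(2) \<phi>I that by blast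
    have new: "g u \<noteq> g v" if uv: "u \<in> X" "v \<in> X - S" "adj u v" for u v
    proof -
      have ne: "\<phi> u \<noteq> \<phi> v" using uv \<phi>(2) by (auto simp: proper_on_def)
      show ?thesis
      proof (cases "\<phi> v = \<phi> s")
        case True
        have "f u \<noteq> f s" if "u \<in> S"
          using inj that s(1) ne True by (auto dest: inj_onD)
        then show ?thesis
          using uv True ne fT[OF s(1) \<pi>T[of u]] by (auto simp: g_def)
      next
        case False
        have "\<pi> (\<phi> u) \<noteq> \<pi> (\<phi> v)" if "\<phi> u \<noteq> \<phi> s"
          using uv \<phi>I[of u] \<phi>I[of v] that False ne \<pi>(1) by (auto dest: inj_onD)
        then show ?thesis
          using uv False fT[OF s(1) \<pi>T[of v]] fT[OF _ \<pi>T[of v], of u] by (auto simp: g_def)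
      qed
    qed
    have "proper_on adj X g"
      unfolding proper_on_def
    proof (intro ballI impI)
      fix u v assume uv: "u \<in> X" "v \<in> X" "adj u v"
      show "g u \<noteq> g v"
      proof (cases "u \<in> S \<and> v \<in> S")
        case True
        then show ?thesis using uv S(2) by (auto simp: g_def proper_on_def)
      next
        case False
        then show ?thesis using new[of u v] new[of v u] uv sym[of u v] by fastforce
      qed
    qed
    moreover have "g v \<notin> F v" if v: "v \<in> X - S" for v
    proof (cases "\<phi> v = \<phi> s")
      case True
      then show ?thesis using v s(2)[OF v] by (simp add: g_def)
    next
      case False
      then have "(\<phi> v, \<pi> (\<phi> v)) \<notin> Bad" using v \<pi>(3) \<phi>I[of v] by simp
      then have "\<pi> (\<phi> v) \<notin> F v" using v unfolding Bad_def by blast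
      then show ?thesis using v False by (simp add: g_def)
    qed
    moreover have "g ` X \<subseteq> {..<m}"
      using S(3) s(1) \<pi>T by (auto simp: g_def T_def)
    ultimately show ?thesis
      unfolding extendable_def by (intro exI[of _ g]) (auto simp: g_def)
  qed
qed

text \<open>
  The two colourings are glued along the cutset \<open>C\<close>, where the second one repeats the first.
  The precolouring handed to the second part is proper because the first one avoided, on \<open>C\<close>,
  all the colours prescribed in \<open>A\<close>. The argument is asymmetric in the sides: \<open>A\<close> must have
  the smaller demand, so that the \<open>k\<^sup>2\<close> for the cutset can be added to it.
\<close>
lemma extendable_if_separable:
  assumes fin: "finite X" "\<And>v. v \<in> X - S \<Longrightarrow> finite (F v)"
    and sym: "\<And>u v. adj u v \<Longrightarrow> adj v u"
    and sep: "separable adj k X"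
    and IH: "\<And>Y S' f' F'. Y \<subset> X \<Longrightarrow> (\<And>v. v \<in> Y - S' \<Longrightarrow> finite (F' v)) \<Longrightarrow> S' \<subseteq> Y \<Longrightarrow>
        proper_on adj S' f' \<Longrightarrow> f' ` S' \<subseteq> {..<m} \<Longrightarrow> demand k S' F' Y < 2 * k\<^sup>2 \<Longrightarrow>
        extendable adj m Y S' f' F'"
    and S: "S \<subseteq> X" "proper_on adj S f" "f ` S \<subseteq> {..<m}"
    and dem: "demand k S F X < 2 * k\<^sup>2"
  shows "extendable adj m X S f F"
proof -
  have main: ?thesis
    if X: "X = A \<union> B \<union> C" and disj: "A \<inter> B = {}" "A \<inter> C = {}" "B \<inter> C = {}"
      and ne: "A \<noteq> {}" "B \<noteq> {}" and C: "card C \<le> k"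
      and no_adj: "\<And>u v. u \<in> A \<Longrightarrow> v \<in> B \<Longrightarrow> \<not> adj u v"
      and small: "demand k S F A \<le> demand k S F B" for A B C
  proof -
    have finABC: "finite A" "finite B" "finite C" using fin(1) X by auto
    then have finS: "finite S" using S(1) X by (meson finite_UnI finite_subset)
    have split: "demand k S F X = demand k S F A + demand k S F B + demand k S F C"
      using finABC disj by (simp add: X demand_Un Int_Un_distrib2)
    \<comment> \<open>forbidding all colours of \<open>S \<inter> A\<close> on \<open>C\<close>, whether or not there is an edge, is affordable\<close>
    define F1 where "F1 v = (if v \<in> C then F v \<union> f ` (S \<inter> A) else F v)" for v
    define S1 where "S1 = S \<inter> (B \<union> C)"
    have F1C: "demand k S1 F1 C \<le> demand k S F C + k * card (S \<inter> A)"
    proof -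
      have "(\<Sum>v\<in>C - S. card (F1 v)) \<le> (\<Sum>v\<in>C - S. card (F v) + card (S \<inter> A))"
      proof (rule sum_mono)
        fix v assume "v \<in> C - S"
        then show "card (F1 v) \<le> card (F v) + card (S \<inter> A)"
          using card_Un_le[of "F v" "f ` (S \<inter> A)"] card_image_le[of "S \<inter> A" f] finS
          by (simp add: F1_def)
      qed
      also have "\<dots> = (\<Sum>v\<in>C - S. card (F v)) + card (C - S) * card (S \<inter> A)"
        by (simp add: sum.distrib)
      also have "card (C - S) * card (S \<inter> A) \<le> k * card (S \<inter> A)"
        using C card_mono[OF finABC(3), of "C - S"] by (intro mult_le_mono1) auto
      finally have "(\<Sum>v\<in>C - S. card (F1 v)) \<le> (\<Sum>v\<in>C - S. card (F v)) + k * card (S \<inter> A)"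
        by simp
      moreover have "S1 \<inter> C = S \<inter> C" "C - S1 = C - S" by (auto simp: S1_def)
      ultimately show ?thesis by (simp add: demand_def)
    qed
    have "demand k S1 F1 B = demand k S F B"
      using disj by (intro demand_cong) (auto simp: S1_def F1_def)
    then have "demand k S1 F1 (B \<union> C) \<le> demand k S F B + demand k S F C + k * card (S \<inter> A)"
      using F1C finABC disj by (simp add: demand_Un)
    also have "k * card (S \<inter> A) \<le> demand k S F A" by (simp add: demand_def)
    finally have dem1: "demand k S1 F1 (B \<union> C) < 2 * k\<^sup>2" using dem split by linarith
    have "extendable adj m (B \<union> C) S1 f F1"
    proof (rule IH[OF _ _ _ _ _ dem1])
      show "B \<union> C \<subset> X" using X disj ne by auto
      show "finite (F1 v)" if "v \<in> B \<union> C - S1" for v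
        using that fin(2)[of v] X finS by (auto simp: F1_def S1_def)
      show "proper_on adj S1 f" using S(2) by (rule proper_on_subset) (auto simp: S1_def)
    qed (use S in \<open>auto simp: S1_def\<close>)
    then obtain g1 where g1: "g1 ` (B \<union> C) \<subseteq> {..<m}" "proper_on adj (B \<union> C) g1"
      "\<And>v. v \<in> (B \<union> C) \<inter> S \<Longrightarrow> g1 v = f v" "\<And>v. v \<in> B \<union> C - S \<Longrightarrow> g1 v \<notin> F1 v"
      unfolding extendable_def by (auto simp: S1_def)
    define S2 where "S2 = (S \<inter> A) \<union> C"
    define f2 where "f2 v = (if v \<in> C then g1 v else f v)" for v
    have "demand k S2 F A = demand k S F A"
      using disj by (intro demand_cong) (auto simp: S2_def)
    moreover have "demand k S2 F C \<le> k * k"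
    proof -
      have "S2 \<inter> C = C" "C - S2 = {}" by (auto simp: S2_def)
      then have "demand k S2 F C = k * card C" by (simp only: demand_def sum.empty add_0_right)
      then show ?thesis using C by simp
    qed
    moreover have "2 * demand k S F A < 2 * k\<^sup>2" using dem split small by linarith
    ultimately have dem2: "demand k S2 F (A \<union> C) < 2 * k\<^sup>2"
      using finABC disj by (simp add: demand_Un power2_eq_square)
    have cross: "f2 u \<noteq> f2 v" if "u \<in> S \<inter> A" "v \<in> C" "adj u v" for u v
    proof (cases "v \<in> S")
      case True
      then show ?thesis
        using that disj S(2) g1(3)[of v] by (auto simp: f2_def proper_on_def)
    next
      case False
      then have "g1 v \<notin> f ` (S \<inter> A)" using that g1(4)[of v] by (simp add: F1_def)
      then have "f u \<noteq> g1 v" using that(1) by (metis imageI)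
      then show ?thesis using that disj by (auto simp: f2_def)
    qed
    have "extendable adj m (A \<union> C) S2 f2 F"
    proof (rule IH[OF _ _ _ _ _ dem2])
      show "A \<union> C \<subset> X" using X disj ne by auto
      show "finite (F v)" if "v \<in> A \<union> C - S2" for v
        using that fin(2)[of v] X by (auto simp: S2_def)
      show "proper_on adj S2 f2"
        unfolding proper_on_def
      proof (intro ballI impI)
        fix u v assume uv: "u \<in> S2" "v \<in> S2" "adj u v"
        consider "u \<in> S \<inter> A" "v \<in> S \<inter> A" | "u \<in> S \<inter> A" "v \<in> C" | "u \<in> C" "v \<in> S \<inter> A"
          | "u \<in> C" "v \<in> C" using uv by (auto simp: S2_def)
        then show "f2 u \<noteq> f2 v"
        proof cases
          case 1
          then show ?thesis using uv S(2) disj by (auto simp: f2_def proper_on_def)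
        next
          case 2
          then show ?thesis using cross uv by blast
        next
          case 3
          then show ?thesis using cross[of v u] sym uv by fastforce
        next
          case 4
          then show ?thesis using uv g1(2) by (auto simp: f2_def proper_on_def)
        qed
      qed
      show "S2 \<subseteq> A \<union> C" by (auto simp: S2_def)
      show "f2 ` S2 \<subseteq> {..<m}" using g1(1) S(3) by (auto simp: f2_def S2_def)
    qed
    then obtain g2 where g2: "g2 ` (A \<union> C) \<subseteq> {..<m}" "proper_on adj (A \<union> C) g2"
      "\<And>v. v \<in> (A \<union> C) \<inter> S2 \<Longrightarrow> g2 v = f2 v" "\<And>v. v \<in> A \<union> C - S2 \<Longrightarrow> g2 v \<notin> F v"
      unfolding extendable_def by auto
    define g where "g v = (if v \<in> A then g2 v else g1 v)" for v
    have gAC: "g v = g2 v" if "v \<in> A \<union> C" for v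
      using that g2(3)[of v] disj by (auto simp: g_def S2_def f2_def)
    have gBC: "g v = g1 v" if "v \<in> B \<union> C" for v
      using that disj by (auto simp: g_def)
    have "proper_on adj X g"
      unfolding proper_on_def
    proof (intro ballI impI)
      fix u v assume uv: "u \<in> X" "v \<in> X" "adj u v"
      then have "(u \<in> A \<union> C \<and> v \<in> A \<union> C) \<or> (u \<in> B \<union> C \<and> v \<in> B \<union> C)"
        using X no_adj sym by blast
      then show "g u \<noteq> g v"
        using uv g1(2) g2(2) gAC gBC unfolding proper_on_def by metis
    qed
    moreover have "g ` X \<subseteq> {..<m}"
      using X g1(1) g2(1) by (auto simp: g_def)
    moreover have "g v = f v" if "v \<in> X \<inter> S" for v
      using that X g1(3)[of v] g2(3)[of v] disj by (auto simp: g_def S2_def f2_def)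
    moreover have "g v \<notin> F v" if "v \<in> X - S" for v
      using that X g1(4)[of v] g2(4)[of v] disj by (auto simp: g_def S2_def F1_def split: if_splits)
    ultimately show ?thesis unfolding extendable_def by blast
  qed
  obtain A B C where sep': "X = A \<union> B \<union> C" "A \<inter> B = {}" "A \<inter> C = {}" "B \<inter> C = {}"
      "A \<noteq> {}" "B \<noteq> {}" "card C \<le> k" "\<forall>u\<in>A. \<forall>v\<in>B. \<not> adj u v"
    using sep unfolding separable_def by blast
  show ?thesis
  proof (cases "demand k S F A \<le> demand k S F B")
    case True
    then show ?thesis using main[of A B C] sep' by blast
  next
    case False
    have "X = B \<union> A \<union> C" "B \<inter> A = {}" using sep' by auto
    then show ?thesis using main[of B A C] False sep' sym by (meson nat_le_linear)
  qed
qed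

lemma extendable_if_all_colourable_or_separable:
  assumes "finite X" "\<And>v. v \<in> X - S \<Longrightarrow> finite (F v)"
    and sym: "\<And>u v. adj u v \<Longrightarrow> adj v u"
    and k: "k \<ge> 1" "2 * k\<^sup>2 \<le> m"
    and "\<And>Y. Y \<subseteq> X \<Longrightarrow> colourable_on adj Y (m + 2 - 2 * k) \<or> separable adj k Y"
    and "S \<subseteq> X" "proper_on adj S f" "f ` S \<subseteq> {..<m}"
    and "demand k S F X < 2 * k\<^sup>2"
  shows "extendable adj m X S f F"
  using assms(1,2,6-10)
proof (induction X arbitrary: S f F rule: finite_psubset_induct)
  case (psubset X)
  show ?case
  proof (cases "colourable_on adj X (m + 2 - 2 * k)")
    case True
    then show ?thesis
      using psubset.prems psubset.hyps sym k by (intro extendable_if_colourable) auto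
  next
    case False
    then have "separable adj k X" using psubset.prems(2) by blast
    then show ?thesis
    proof (rule extendable_if_separable[where adj = adj and k = k and X = X, rotated 3])
      fix Y S' f' F'
      assume Y: "Y \<subset> X" "\<And>v. v \<in> Y - S' \<Longrightarrow> finite (F' v :: nat set)" "S' \<subseteq> Y"
        "proper_on adj S' f'" "f' ` S' \<subseteq> {..<m}" "demand k S' F' Y < 2 * k\<^sup>2"
      show "extendable adj m Y S' f' F'"
        by (rule psubset.IH[OF Y(1) Y(2) _ Y(3-6)]) (use Y(1) psubset.prems(2) in auto)
    qed (use psubset.prems psubset.hyps sym in auto)
  qed
qed

section \<open>Chromatic number and connectivity\<close>

lemma chromatic_number_colouring:
  assumes "finite (verts G)" "loopfree_digraph G"
  shows "\<exists>f :: 'a \<Rightarrow> nat. f ` verts G \<subseteq> {..<chromatic_number G} \<and>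
    proper_colouring (G :: ('a, 'b) pre_digraph) f"
proof -
  interpret loopfree_digraph G by fact
  obtain f :: "'a \<Rightarrow> nat" where f: "inj_on f (verts G)"
    using finite_imp_inj_to_nat_seg[OF assms(1)] by blast
  have "f ` verts G \<subseteq> {..<Suc (Max (f ` verts G))}"
    using assms(1) by (auto simp: less_Suc_eq_le)
  moreover have "proper_colouring G f"
    using f no_loops by (auto simp: proper_colouring_def arcs_ends_conv dest!: inj_onD)
  ultimately have "\<exists>n. \<exists>f :: 'a \<Rightarrow> nat. f ` verts G \<subseteq> {..<n} \<and> proper_colouring G f" by blast
  then show ?thesis unfolding chromatic_number_def by (rule LeastI_ex)
qed

lemma chromatic_number_le:
  assumes "f ` verts G \<subseteq> {..<n}" "proper_colouring G (f :: 'a \<Rightarrow> nat)"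
  shows "chromatic_number (G :: ('a, 'b) pre_digraph) \<le> n"
  unfolding chromatic_number_def using assms by (intro Least_le) blast

text \<open>
  One side consists of the vertices reachable from a vertex that does not reach all others.
\<close>
lemma not_connected_split:
  assumes "verts H \<noteq> {}" "\<not> connected H"
  shows "\<exists>A B. verts H = A \<union> B \<and> A \<inter> B = {} \<and> A \<noteq> {} \<and> B \<noteq> {} \<and> (\<forall>u\<in>A. \<forall>v\<in>B. \<not> u \<rightarrow>\<^bsub>H\<^esub> v)"
proof -
  let ?R = "mk_symmetric H"
  obtain a b where ab: "a \<in> verts H" "b \<in> verts H" "\<not> a \<rightarrow>\<^sup>*\<^bsub>?R\<^esub> b"
    using assms by (auto simp: connected_def strongly_connected_def)
  define A where "A = {v \<in> verts H. a \<rightarrow>\<^sup>*\<^bsub>?R\<^esub> v}"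
  have "a \<rightarrow>\<^sup>*\<^bsub>?R\<^esub> a" using ab(1) by (auto simp: reachable_def intro: rtrancl_on_refl)
  moreover have "\<not> u \<rightarrow>\<^bsub>H\<^esub> v" if "u \<in> A" "v \<in> verts H - A" for u v
  proof
    assume "u \<rightarrow>\<^bsub>H\<^esub> v"
    then have "(u, v) \<in> parcs ?R" by (force simp: parcs_mk_symmetric arcs_ends_conv)
    then have "a \<rightarrow>\<^sup>*\<^bsub>?R\<^esub> v"
      using that by (auto simp: A_def reachable_def intro: rtrancl_on_into_rtrancl_on)
    then show False using that by (simp add: A_def)
  qed
  ultimately show ?thesis
    using ab by (intro exI[of _ A] exI[of _ "verts H - A"]) (auto simp: A_def)
qed

lemma dominates_induce_iff: 
  "u \<in> Y \<Longrightarrow> v \<in> Y \<Longrightarrow> u \<rightarrow>\<^bsub>G \<restriction> Y\<^esub> v \<longleftrightarrow> u \<rightarrow>\<^bsub>G\<^esub> v"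
  by (auto simp: arcs_ends_conv)

text \<open>
  This is where connectivity enters the colouring argument. Small vertex sets are treated
  apart, since they fail to be \<open>(k + 1)\<close>-connected without having a cutset; there a colouring
  with all colours distinct serves instead.
\<close>
lemma colourable_on_or_separable:
  assumes G: "Digraph.graph G" and Y: "Y \<subseteq> verts G"
    and p: "k + 1 \<le> p" "c \<le> p"
    and no: "\<And>H. induced_subgraph H G \<Longrightarrow> k_connected (k + 1) H \<Longrightarrow> chromatic_number H \<le> c"
  shows "colourable_on (dominates G) Y p \<or> separable (dominates G) k Y"
proof -
  interpret graph G by (fact G)
  let ?H = "G \<restriction> Y"
  have finY: "finite Y" using Y finite_verts by (rule finite_subset)
  have ind: "induced_subgraph ?H G" using Y by (rule induced_induce)
  have loopfree: "loopfree_digraph ?H"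
    using digraph_subgraph[OF induced_imp_subgraph[OF ind]] by (simp add: digraph_def)
  consider "card Y \<le> k + 1" | "k_connected (k + 1) ?H"
    | C where "k + 1 < card Y" "cutset ?H C" "card C < k + 1"
    by (force simp: k_connected_def)
  then show ?thesis
  proof cases
    case 1
    obtain h where h: "inj_on h Y" "h ` Y \<subseteq> {..<p}"
      using card_le_inj[of Y "{..<p}"] 1 p(1) finY by auto
    have "proper_on (dominates G) Y h"
      using h(1) no_loops by (auto simp: proper_on_def arcs_ends_conv dest!: inj_onD)
    then show ?thesis using h(2) unfolding colourable_on_def by blast
  next
    case 2
    have "chromatic_number ?H \<le> p" using no[OF ind 2] p(2) by simp
    then obtain h :: "'a \<Rightarrow> nat" where "h ` Y \<subseteq> {..<p}" "proper_colouring ?H h"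
      using chromatic_number_colouring[OF _ loopfree] finY by force
    then show ?thesis
      unfolding colourable_on_def proper_on_def proper_colouring_def
      by (auto simp: dominates_induce_iff)
  next
    case 3
    have C: "C \<subseteq> Y" "C \<noteq> Y" "\<not> connected (?H \<restriction> (Y - C))"
      using 3(2) by (auto simp: cutset_def)
    then have "verts (?H \<restriction> (Y - C)) \<noteq> {}" by auto
    with C(3) obtain A B where AB: "Y - C = A \<union> B" "A \<inter> B = {}" "A \<noteq> {}" "B \<noteq> {}"
        "\<forall>u\<in>A. \<forall>v\<in>B. \<not> u \<rightarrow>\<^bsub>?H \<restriction> (Y - C)\<^esub> v"
      using not_connected_split[of "?H \<restriction> (Y - C)"] unfolding induce_subgraph_verts by blast
    have "\<not> u \<rightarrow>\<^bsub>G\<^esub> v" if "u \<in> A" "v \<in> B" for u v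
      using that AB(1,5) dominates_induce_iff[of u "Y - C" v ?H] dominates_induce_iff[of u Y v G]
      by blast
    moreover have "Y = A \<union> B \<union> C" "A \<inter> C = {}" "B \<inter> C = {}" using AB(1) C(1) by auto
    ultimately have "separable (dominates G) k Y"
      unfolding separable_def using AB(2-4) 3(3)
      by (intro exI[of _ A] exI[of _ B] exI[of _ C]) auto
    then show ?thesis ..
  qed
qed

theorem theorem2p12:
  fixes G :: "('a, 'b) pre_digraph" and k c :: nat
  assumes "Digraph.graph G"
    and "k \<ge> 1"
    and "chromatic_number G > max (c + 2 * k - 2) (2 * k ^ 2)"
  shows "\<exists>H. induced_subgraph H G \<and> k_connected (k + 1) H \<and> chromatic_number H > c"
proof (rule ccontr)
  assume "\<not> ?thesis"
  then have no: "chromatic_number H \<le> c" if "induced_subgraph H G" "k_connected (k + 1) H" for H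
    using that by (meson not_less)
  interpret graph G by (fact assms(1))
  define m where "m = max (c + 2 * k - 2) (2 * k ^ 2)"
  have p: "k + 1 \<le> m + 2 - 2 * k" "c \<le> m + 2 - 2 * k"
    unfolding m_def using assms(2) three_mult_le[of k] by linarith+
  have "extendable (dominates G) m (verts G) {} (\<lambda>_. 0) (\<lambda>_. {})"
    using assms(2) graph_symmetric colourable_on_or_separable[OF assms(1) _ p no]
    by (intro extendable_if_all_colourable_or_separable[where k = k])
      (auto simp: m_def proper_on_def demand_def)
  then obtain g where "g ` verts G \<subseteq> {..<m}" "proper_colouring G g"
    by (auto simp: extendable_def proper_on_def proper_colouring_def)
  then have "chromatic_number G \<le> m" by (rule chromatic_number_le)
  with assms(3) show False unfolding m_def by linarith
qed

end
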